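(* Let $a_1,a_2,b_1,b_2\in\mathbb{R}$ satisfy $a_1\ge 0$, $a_2\ge 0$, $b_1\le 0\le b_2$ and $b_2-b_1>0$, and let $f:\mathbb{R}\to\mathbb{R}$ be $f(x)=\frac12 a_1x^2+b_1x$ for $x\le 0$ and $f(x)=\frac12 a_2x^2+b_2x$ for $x\ge 0$. Let $C=[\lambda_1,\lambda_2]$ with $\lambda_1\le 0\le\lambda_2$ and $\lambda_2-\lambda_1>0$, and let $\widetilde f = f+\iota_C$. Let $x\in\mathbb{R}$ and let $\alpha,\beta$ be two positive numbers; put $f_\alpha := f-\mathrm{env}_{\alpha f}$ and $\widetilde f_\alpha := \widetilde f-\mathrm{env}_{\alpha \widetilde f}$. Then the following statements hold. (i) If the set $\mathrm{prox}_{\beta f_\alpha}(x)\cap C$ is not empty, then $\mathrm{prox}_{\beta f_\alpha}(x)\cap C\subseteq \mathrm{prox}_{\beta\widetilde f_\alpha}(x)$. (ii) If $\lambda_2\in\mathrm{prox}_{\beta\widetilde f_\alpha}(x)$, then $\lambda_2\in\mathrm{prox}_{\beta\widetilde f_\alpha}(y)$ for all $y>x$. (iii) If $\lambda_1\in\mathrm{prox}_{\beta\widetilde f_\alpha}(x)$, then $\lambda_1\in\mathrm{prox}_{\beta\widetilde f_\alpha}(y)$ for all $y<x$.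
   Context: $\iota_C$ is the indicator function of $C$: $\iota_C(x)=0$ if $x\in C$ and $+\infty$ otherwise. For a proper lower semicontinuous $g:\mathbb{R}\to(-\infty,+\infty]$ and $\alpha>0$: $\mathrm{env}_{\alpha g}(x)=\inf_{u\in\mathbb{R}}\{g(u)+\frac{1}{2\alpha}(u-x)^2\}$, and $\mathrm{prox}_{\alpha g}(x)=\mathrm{argmin}_{u\in\mathbb{R}}\{g(u)+\frac{1}{2\alpha}(u-x)^2\}$, which is a set. *)

theory Defs
  imports "HOL-Library.Extended_Real"
begin

definition indicator_fn :: "real set \<Rightarrow> real \<Rightarrow> ereal" where
  "indicator_fn C x = (if x \<in> C then 0 else \<infinity>)"

definition moreau_obj :: "real \<Rightarrow> (real \<Rightarrow> ereal) \<Rightarrow> real \<Rightarrow> real \<Rightarrow> ereal" where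
  "moreau_obj \<alpha> g x u = g u + ereal (1 / (2 * \<alpha>) * (u - x)\<^sup>2)"

definition env :: "real \<Rightarrow> (real \<Rightarrow> ereal) \<Rightarrow> real \<Rightarrow> ereal" where
  "env \<alpha> g x = (INF u. moreau_obj \<alpha> g x u)"

definition prox :: "real \<Rightarrow> (real \<Rightarrow> ereal) \<Rightarrow> real \<Rightarrow> real set" where
  "prox \<alpha> g x = {u. is_arg_min (moreau_obj \<alpha> g x) (\<lambda>_. True) u}"

(* Subtraction on ereal satisfies \<infinity> - \<infinity> = \<infinity>. This convention is not exercised when g is
   proper and bounded below, since the envelope is then real-valued. *)
definition minus_env :: "real \<Rightarrow> (real \<Rightarrow> ereal) \<Rightarrow> real \<Rightarrow> ereal" where
  "minus_env \<alpha> g x = g x - env \<alpha> g x"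

end

theory Submission
  imports Defs
begin

text \<open>
  The function \<open>f\<close> decreases up to \<open>0\<close> and increases afterwards, and \<open>0\<close> lies in the interval \<open>C\<close>.
  Projecting a point \<open>u\<close> onto \<open>C\<close> therefore does not increase \<open>f\<close>, and it brings \<open>u\<close> closer to every
  point of \<open>C\<close>. So for base points in \<open>C\<close> the infimum that defines the envelope may be taken over \<open>C\<close>
  only, and the envelopes of \<open>f\<close> and of \<open>f + \<iota>\<^sub>C\<close> agree on \<open>C\<close> (lemma \<open>env_add_indicator\<close>). The
  differences \<open>f\<^sub>\<alpha>\<close> and \<open>f'\<^sub>\<alpha>\<close> then agree on \<open>C\<close> as well, while \<open>f'\<^sub>\<alpha>\<close> is infinite elsewhere.
  Hence a global minimiser of the proximal objective of \<open>f\<^sub>\<alpha>\<close> that happens to lie in \<open>C\<close> also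
  minimises that of \<open>f'\<^sub>\<alpha>\<close>, which is the first claim.

  The other two claims hold because \<open>f'\<^sub>\<alpha>\<close> is infinite outside \<open>C\<close>. Moving the base point from \<open>x\<close>
  to \<open>y\<close> adds to the proximal objective an affine function of \<open>u\<close> with slope
  \<open>(x - y) / \<beta>\<close>. When the base point moves right, this function favours larger \<open>u\<close>, so a minimiser at
  the right end of the domain stays one; symmetrically at the left end
  (lemma \<open>prox_extreme_point\<close>).
\<close>

lemma mem_prox_iff:
  "u \<in> prox \<alpha> g x \<longleftrightarrow> (\<forall>v. moreau_obj \<alpha> g x u \<le> moreau_obj \<alpha> g x v)"
  by (auto simp: prox_def is_arg_min_def not_less)

lemma moreau_obj_change_base:
  "moreau_obj \<alpha> g y u = moreau_obj \<alpha> g x u + ereal (1 / (2 * \<alpha>) * ((y - x) * (x + y - 2 * u)))"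
proof -
  have "(u - y)\<^sup>2 = (u - x)\<^sup>2 + (y - x) * (x + y - 2 * u)"
    by (simp add: power2_eq_square algebra_simps)
  hence "1 / (2 * \<alpha>) * (u - y)\<^sup>2
      = 1 / (2 * \<alpha>) * (u - x)\<^sup>2 + 1 / (2 * \<alpha>) * ((y - x) * (x + y - 2 * u))"
    by (simp only: distrib_left)
  thus ?thesis
    by (simp only: moreau_obj_def plus_ereal.simps(1)[symmetric] add.assoc)
qed

text \<open>
  The hypothesis \<open>extreme\<close> says that no point of the domain of \<open>g\<close> lies beyond \<open>u\<close> in the direction
  of the move from \<open>x\<close> to \<open>y\<close>; stated through the sign of a product, it serves both ends of an
  interval at once.
\<close>

lemma prox_extreme_point:
  assumes "\<alpha> > 0" and u: "u \<in> prox \<alpha> g x"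
    and extreme: "\<And>v. g v \<noteq> \<infinity> \<Longrightarrow> (y - x) * (v - u) \<le> 0"
  shows "u \<in> prox \<alpha> g y"
  unfolding mem_prox_iff
proof
  fix v
  show "moreau_obj \<alpha> g y u \<le> moreau_obj \<alpha> g y v"
  proof (cases "g v = \<infinity>")
    case True
    thus ?thesis by (simp add: moreau_obj_def)
  next
    case False
    have "(y - x) * (x + y - 2 * u) \<le> (y - x) * (x + y - 2 * v)"
      using extreme[OF False] by (simp add: algebra_simps)
    hence "1 / (2 * \<alpha>) * ((y - x) * (x + y - 2 * u)) \<le> 1 / (2 * \<alpha>) * ((y - x) * (x + y - 2 * v))"
      using \<open>\<alpha> > 0\<close> by (intro mult_left_mono[of _ _ "1 / (2 * \<alpha>)"]) auto
    thus ?thesis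
      using u unfolding mem_prox_iff moreau_obj_change_base[of \<alpha> g y _ x]
      by (intro add_mono) auto
  qed
qed

text \<open>
  An infinite penalty outside \<open>C\<close> removes only competitors, so it keeps every minimiser in \<open>C\<close>.
\<close>

lemma prox_Int_subset_of_agree:
  assumes agree: "\<And>u. u \<in> C \<Longrightarrow> g u = h u" and outside: "\<And>u. u \<notin> C \<Longrightarrow> h u = \<infinity>"
  shows "prox \<alpha> g x \<inter> C \<subseteq> prox \<alpha> h x"
proof
  fix u assume "u \<in> prox \<alpha> g x \<inter> C"
  hence u: "u \<in> C" and min: "moreau_obj \<alpha> g x u \<le> moreau_obj \<alpha> g x v" for v
    by (auto simp: mem_prox_iff)
  have "moreau_obj \<alpha> h x u \<le> moreau_obj \<alpha> h x v" for v
  proof (cases "v \<in> C")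
    case True
    thus ?thesis using min[of v] u by (simp add: moreau_obj_def agree)
  next
    case False
    thus ?thesis by (simp add: moreau_obj_def outside)
  qed
  thus "u \<in> prox \<alpha> h x" by (simp add: mem_prox_iff)
qed

text \<open>
  The constrained infimum is bounded by the free one because each competitor \<open>u\<close> can be replaced by
  its projection onto \<open>{l..r}\<close>. The projection moves \<open>u\<close> towards \<open>m\<close>, where \<open>f\<close> has its minimum, and
  towards \<open>t\<close>.
\<close>

lemma env_add_indicator:
  fixes f :: "real \<Rightarrow> real"
  assumes "\<alpha> > 0"
    and dec: "antimono_on {..m} f" and inc: "mono_on {m..} f"
    and m: "l \<le> m" "m \<le> r" and t: "t \<in> {l..r}"
  shows "env \<alpha> (\<lambda>u. ereal (f u) + indicator_fn {l..r} u) t = env \<alpha> (\<lambda>u. ereal (f u)) t"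
    (is "env \<alpha> ?h t = env \<alpha> ?g t")
proof (rule antisym)
  show "env \<alpha> ?h t \<le> env \<alpha> ?g t"
    unfolding env_def
  proof (rule INF_greatest)
    fix u
    define c where "c = max l (min r u)"
    have c: "c \<in> {l..r}"
      using m by (auto simp: c_def)
    have "f c \<le> f u"
    proof -
      consider "u < l" | "r < u" | "c = u"
        by (force simp: c_def)
      thus ?thesis
      proof cases
        case 1
        hence "c = l" using m by (simp add: c_def)
        thus ?thesis using monotone_onD[OF dec, of u l] 1 m by simp
      next
        case 2
        hence "c = r" using m by (simp add: c_def)
        thus ?thesis using monotone_onD[OF inc, of r u] 2 m by simp
      qed simp
    qed
    moreover have "(c - t)\<^sup>2 \<le> (u - t)\<^sup>2"
    proof -
      have "\<bar>c - t\<bar> \<le> \<bar>u - t\<bar>"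
        using t by (auto simp: c_def)
      thus ?thesis by (simp only: abs_le_square_iff)
    qed
    ultimately have "f c + 1 / (2 * \<alpha>) * (c - t)\<^sup>2 \<le> f u + 1 / (2 * \<alpha>) * (u - t)\<^sup>2"
      using \<open>\<alpha> > 0\<close> by (intro add_mono mult_left_mono) auto
    hence "moreau_obj \<alpha> ?h t c \<le> moreau_obj \<alpha> ?g t u"
      using c by (simp add: moreau_obj_def indicator_fn_def)
    thus "(INF u. moreau_obj \<alpha> ?h t u) \<le> moreau_obj \<alpha> ?g t u"
      by (rule INF_lower2[OF UNIV_I])
  qed
  show "env \<alpha> ?g t \<le> env \<alpha> ?h t"
    unfolding env_def
    by (rule INF_mono') (simp add: moreau_obj_def indicator_fn_def)
qed

lemma mono_on_quadratic:
  fixes a b :: real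
  assumes "a \<ge> 0" and "b \<ge> 0"
  shows "mono_on {0..} (\<lambda>t. 1/2 * a * t\<^sup>2 + b * t)"
  using assms by (intro mono_onI add_mono mult_left_mono power_mono) auto

theorem theorem4:
  fixes a1 a2 b1 b2 l1 l2 x \<alpha> \<beta> :: real
    and f :: "real \<Rightarrow> real" and C :: "real set" and f' :: "real \<Rightarrow> ereal"
    and f_\<alpha> f'_\<alpha> :: "real \<Rightarrow> ereal"
  assumes "a1 \<ge> 0" and "a2 \<ge> 0" and "b1 \<le> 0" and "0 \<le> b2" and "b2 - b1 > 0"
    and f_nonpos: "\<And>t. t \<le> 0 \<Longrightarrow> f t = 1/2 * a1 * t\<^sup>2 + b1 * t"
    and f_nonneg: "\<And>t. t \<ge> 0 \<Longrightarrow> f t = 1/2 * a2 * t\<^sup>2 + b2 * t"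
    and "l1 \<le> 0" and "0 \<le> l2" and "l2 - l1 > 0"
    and C_eq: "C = {l1..l2}"
    and f'_eq: "f' = (\<lambda>t. ereal (f t) + indicator_fn C t)"
    and "\<alpha> > 0" and "\<beta> > 0"
    and f_\<alpha>_eq: "f_\<alpha> = minus_env \<alpha> (\<lambda>t. ereal (f t))"
    and f'_\<alpha>_eq: "f'_\<alpha> = minus_env \<alpha> f'"
  shows "(prox \<beta> f_\<alpha> x \<inter> C \<noteq> {} \<longrightarrow> prox \<beta> f_\<alpha> x \<inter> C \<subseteq> prox \<beta> f'_\<alpha> x)
    \<and> (l2 \<in> prox \<beta> f'_\<alpha> x \<longrightarrow> (\<forall>y>x. l2 \<in> prox \<beta> f'_\<alpha> y))
    \<and> (l1 \<in> prox \<beta> f'_\<alpha> x \<longrightarrow> (\<forall>y<x. l1 \<in> prox \<beta> f'_\<alpha> y))"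
proof -
  have inc: "mono_on {0..} f"
    using mono_on_quadratic[OF \<open>a2 \<ge> 0\<close> \<open>0 \<le> b2\<close>]
    by (auto simp: monotone_on_def f_nonneg)
  have dec: "antimono_on {..0} f"
  proof (rule monotone_onI)
    fix s t :: real assume st: "s \<in> {..0}" "t \<in> {..0}" "s \<le> t"
    (* The left branch is the reflection of an increasing quadratic. *)
    have "1/2 * a1 * (- t)\<^sup>2 + (- b1) * (- t) \<le> 1/2 * a1 * (- s)\<^sup>2 + (- b1) * (- s)"
      using st \<open>b1 \<le> 0\<close> by (intro monotone_onD[OF mono_on_quadratic] \<open>a1 \<ge> 0\<close>) auto
    thus "f s \<ge> f t" using st by (simp add: f_nonpos)
  qed
  have env_eq: "env \<alpha> f' t = env \<alpha> (\<lambda>t. ereal (f t)) t" if "t \<in> C" for t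
    unfolding f'_eq C_eq
    using env_add_indicator[OF \<open>\<alpha> > 0\<close> dec inc \<open>l1 \<le> 0\<close> \<open>0 \<le> l2\<close>] that by (simp add: C_eq)
  have agree: "f_\<alpha> t = f'_\<alpha> t" if "t \<in> C" for t
    using that env_eq[OF that]
    by (simp add: f_\<alpha>_eq f'_\<alpha>_eq minus_env_def f'_eq indicator_fn_def)
  have outside: "f'_\<alpha> t = \<infinity>" if "t \<notin> C" for t
    using that by (simp add: f'_\<alpha>_eq minus_env_def f'_eq indicator_fn_def)
  have domain: "l1 \<le> t \<and> t \<le> l2" if "f'_\<alpha> t \<noteq> \<infinity>" for t
    using outside[of t] that by (auto simp: C_eq)
  have "prox \<beta> f_\<alpha> x \<inter> C \<subseteq> prox \<beta> f'_\<alpha> x"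
    by (rule prox_Int_subset_of_agree[OF agree outside])
  moreover have "l2 \<in> prox \<beta> f'_\<alpha> y" if "l2 \<in> prox \<beta> f'_\<alpha> x" "y > x" for y
    using that(2) domain
    by (intro prox_extreme_point[OF \<open>\<beta> > 0\<close> that(1)] mult_nonneg_nonpos) auto
  moreover have "l1 \<in> prox \<beta> f'_\<alpha> y" if "l1 \<in> prox \<beta> f'_\<alpha> x" "y < x" for y
    using that(2) domain
    by (intro prox_extreme_point[OF \<open>\<beta> > 0\<close> that(1)] mult_nonpos_nonneg) auto
  ultimately show ?thesis by blast
qed

end
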